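(* Let $d\geq 5$ be an odd squarefree integer, let $d'=\varphi(d)/2$, and let $n$ be an integer with $0\leq n\leq d'$. Put $$F_{d,n}=\max\left(\{\varphi(f)/2 : f\mid d,\ 1<f\leq n\}\cup\{|1+\sqrt{D}|/2\}\right).$$ Then $$\left|a_{d,n}+b_{d,n}\sqrt{D}\right|\leq \frac{2F_{d,n}(F_{d,n}+1)\cdots(F_{d,n}+n-1)}{n!},$$ and, putting $$G_{d,n}=\max\left(\{\varphi(f)/2 : f\mid d,\ 1<f\leq n\}\cup\{|1+\sqrt{d}|/2\}\right),$$ we have $$|a_{d,n}|+|b_{d,n}|\sqrt{d}\leq \frac{2G_{d,n}(G_{d,n}+1)\cdots(G_{d,n}+n-1)}{n!}.$$
   Context: Here $\varphi$ is the Euler totient function and, for an odd squarefree integer $d\ge 5$, $D=(-1)^{(d-1)/2}d$, with $\sqrt{D}=\sqrt{d}$ if $d\equiv 1\pmod 4$ and $\sqrt{D}=i\sqrt{d}$ if $d\equiv 3\pmod 4$; $|\cdot|$ is the complex absolute value. With $(\cdot/d)$ the Jacobi symbol, put $$U_d^{\pm}(X)=\prod_{1\leq k\leq d,\ (k/d)=\pm1}\left(X-e^{2\pi i k/d}\right),\quad \Psi_d(X)=U_d^+(X)+U_d^-(X),\quad \Xi_d(X)=\frac{U_d^-(X)-U_d^+(X)}{\sqrt{D}}.$$ These are polynomials with integer coefficients satisfying the Gauss-Kraïtchik formula $4\Phi_d(X)=\Psi_d(X)^2-D\,\Xi_d(X)^2$, where $\Phi_d$ is the $d$-th cyclotomic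 polynomial; $\Psi_d$ has degree $d'=\varphi(d)/2$ and $\Xi_d$ has degree $d'-1$. Their coefficients are denoted by $$\Psi_d(X)=\sum_{n=0}^{d'}a_{d,n}X^{d'-n},\qquad \Xi_d(X)=\sum_{n=1}^{d'}b_{d,n}X^{d'-n},$$ and $b_{d,0}=0$. For $n=0$ the product $F(F+1)\cdots(F+n-1)$ is the empty product, equal to $1$. *)

theory Defs
  imports
    "HOL-Computational_Algebra.Computational_Algebra"
    "HOL-Number_Theory.Number_Theory"
begin

definition Jacobi :: "int \<Rightarrow> nat \<Rightarrow> int" where
  "Jacobi k d = (\<Prod>p\<in>#prime_factorization d. Legendre k (int p))"

definition discr :: "nat \<Rightarrow> int" where
  "discr d = (-1) ^ ((d - 1) div 2) * int d"

(* For odd d, this is the square root of discr d selected by the congruence of d modulo 4. *)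
definition sqrt_discr :: "nat \<Rightarrow> complex" where
  "sqrt_discr d =
     (if d mod 4 = 1 then of_real (sqrt (real d)) else \<i> * of_real (sqrt (real d)))"

lemma sqrt_discr_power2:
  assumes "odd d"
  shows "sqrt_discr d ^ 2 = of_int (discr d)"
proof (cases "d mod 4 = 1")
  case True
  then obtain m where "d = 4 * m + 1"
    by (metis mult_div_mod_eq)
  then show ?thesis
    by (simp add: sqrt_discr_def discr_def flip: of_real_power)
next
  case False
  with assms have "d mod 4 = 3"
    by presburger
  then obtain m where m: "d = 4 * m + 3"
    by (metis mult_div_mod_eq)
  have "(d - 1) div 2 = Suc (2 * m)"
    using m by simp
  moreover have "d mod 4 \<noteq> 1"
    using False .
  ultimately show ?thesis
    by (simp add: sqrt_discr_def discr_def power_mult_distrib flip: of_real_power)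
qed

definition U_poly :: "int \<Rightarrow> nat \<Rightarrow> complex poly" where
  "U_poly s d =
     (\<Prod>k\<in>{k. 1 \<le> k \<and> k \<le> d \<and> Jacobi (int k) d = s}.
        [:- exp (2 * of_real pi * \<i> * of_nat k / of_nat d), 1:])"

definition Psi_poly :: "nat \<Rightarrow> complex poly" where
  "Psi_poly d = U_poly 1 d + U_poly (-1) d"

definition Xi_poly :: "nat \<Rightarrow> complex poly" where
  "Xi_poly d = Polynomial.smult (1 / sqrt_discr d) (U_poly (-1) d - U_poly 1 d)"

(* The coefficients are numbered from the top, degree totient d div 2 having index 0, so they
   are meaningful only for n \<le> totient d div 2 (beyond that the subtraction truncates).
   They are integers for odd squarefree d \<ge> 5, but are kept here as complex numbers. *)
definition a_coeff :: "nat \<Rightarrow> nat \<Rightarrow> complex" where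
  "a_coeff d n = Polynomial.coeff (Psi_poly d) (totient d div 2 - n)"

definition b_coeff :: "nat \<Rightarrow> nat \<Rightarrow> complex" where
  "b_coeff d n = (if n = 0 then 0 else Polynomial.coeff (Xi_poly d) (totient d div 2 - n))"

definition F_max :: "nat \<Rightarrow> nat \<Rightarrow> real" where
  "F_max d n = Max ({real (totient f) / 2 |f. f dvd d \<and> 1 < f \<and> f \<le> n}
                     \<union> {cmod (1 + sqrt_discr d) / 2})"

definition G_max :: "nat \<Rightarrow> nat \<Rightarrow> real" where
  "G_max d n = Max ({real (totient f) / 2 |f. f dvd d \<and> 1 < f \<and> f \<le> n}
                     \<union> {\<bar>1 + sqrt (real d)\<bar> / 2})"

end

theory Submission
  imports Defs
begin

text \<open>
  Reversing \<open>U_poly s d\<close> gives \<open>\<Prod>(1 - \<zeta>\<^sup>k X)\<close>, whose coefficients satisfy Newton's recursion in the power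
  sums \<open>\<Sum>\<zeta>\<^sup>k\<^sup>m\<close> over \<open>(k/d) = s\<close>. Such a power sum equals \<open>(c(m) + s G(m)) / 2\<close> with the Ramanujan sum
  \<open>c(m) = \<plusminus>\<phi>(gcd d m)\<close> and the Gauss sum \<open>G(m) = (m/d) \<tau>\<close>, \<open>\<tau>\<^sup>2 = D\<close>, so for \<open>1 \<le> m \<le> n\<close> it is bounded
  by \<open>F\<close>. Hence the recursion is majorized by that of \<open>(1 - X)\<^sup>-\<^sup>F\<close>, whose coefficients are
  \<open>F (F + 1) \<cdots> (F + n - 1) / n!\<close>. The second bound follows in the same way from the recursion for the
  pairs \<open>(a, b \<surd>D)\<close>, measured by the sum of the absolute values of the two components. The sign of
  \<open>\<tau>\<close> relative to \<open>\<surd>D\<close> is irrelevant.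
\<close>

section \<open>Complete residue systems and roots of unity\<close>

text \<open>Multiplication by a unit permutes the residues modulo \<open>d\<close>: it is injective
  on a finite set, hence onto.\<close>

lemma sum_residues_mult:
  fixes f :: "int \<Rightarrow> 'a::comm_monoid_add"
  assumes per: "\<And>k. f (k mod d) = f k" and "d > 0" and "coprime u d"
  shows "(\<Sum>k\<in>{0..<d}. f (u * k)) = (\<Sum>k\<in>{0..<d}. f k)"
proof -
  have inj: "inj_on (\<lambda>k. u * k mod d) {0..<d}"
  proof (rule inj_onI)
    fix x y assume xy: "x \<in> {0..<d}" "y \<in> {0..<d}" and "u * x mod d = u * y mod d"
    then have "[x = y] (mod d)"
      using \<open>coprime u d\<close> cong_mult_lcancel unfolding cong_def by blast
    then show "x = y"
      using xy by (simp add: cong_def)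
  qed
  have im: "(\<lambda>k. u * k mod d) ` {0..<d} = {0..<d}"
    by (rule endo_inj_surj[OF _ _ inj]) (use \<open>d > 0\<close> in auto)
  have "(\<Sum>k\<in>{0..<d}. f k) = (\<Sum>k\<in>(\<lambda>k. u * k mod d) ` {0..<d}. f k)"
    by (simp only: im)
  also have "\<dots> = (\<Sum>k\<in>{0..<d}. f (u * k))"
    by (subst sum.reindex[OF inj]) (simp add: per)
  finally show ?thesis ..
qed

text \<open>Chinese remainder theorem with the representatives \<open>x * b + y * a\<close>: divided
  by \<open>a * b\<close> they become x/a + y/b, so additive characters split into a product.
  Injectivity is read off modulo \<open>a\<close> and modulo \<open>b\<close>; surjectivity follows
  by counting.\<close>

lemma sum_residues_crt:
  fixes f :: "int \<Rightarrow> 'a::comm_monoid_add"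
  assumes per: "\<And>k. f (k mod (a * b)) = f k" and "a > 0" "b > 0" and "coprime a b"
  shows "(\<Sum>k\<in>{0..<a * b}. f k) = (\<Sum>(x, y)\<in>{0..<a} \<times> {0..<b}. f (x * b + y * a))"
proof -
  let ?h = "\<lambda>(x, y). (x * b + y * a) mod (a * b)"
  have inj: "inj_on ?h ({0..<a} \<times> {0..<b})"
  proof (rule inj_onI)
    fix z z' assume z: "z \<in> {0..<a} \<times> {0..<b}" "z' \<in> {0..<a} \<times> {0..<b}" and eq: "?h z = ?h z'"
    obtain x y x' y' where zz: "z = (x, y)" "z' = (x', y')"
      by (cases z, cases z')
    have c: "[x * b + y * a = x' * b + y' * a] (mod (a * b))"
      using eq by (simp add: zz cong_def)
    then have "[x * b + y * a = x' * b + y' * a] (mod a)"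
      by (rule cong_modulus_mult)
    then have "[x * b = x' * b] (mod a)"
      by (simp add: cong_def)
    then have "[x = x'] (mod a)"
      using \<open>coprime a b\<close> by (simp add: cong_mult_rcancel coprime_commute)
    moreover have "[x * b + y * a = x' * b + y' * a] (mod b)"
      using c by (metis cong_modulus_mult mult.commute)
    then have "[y * a = y' * a] (mod b)"
      by (simp add: cong_def)
    then have "[y = y'] (mod b)"
      using \<open>coprime a b\<close> by (simp add: cong_mult_rcancel)
    ultimately show "z = z'"
      using z by (simp add: zz cong_def)
  qed
  have "?h ` ({0..<a} \<times> {0..<b}) \<subseteq> {0..<a * b}"
    using assms by auto
  moreover have "card (?h ` ({0..<a} \<times> {0..<b})) = card {0..<a * b}"
    using assms by (subst card_image[OF inj]) (simp add: card_cartesian_product nat_mult_distrib)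
  ultimately have im: "?h ` ({0..<a} \<times> {0..<b}) = {0..<a * b}"
    by (intro card_subset_eq) auto
  have "(\<Sum>k\<in>{0..<a * b}. f k) = (\<Sum>k\<in>?h ` ({0..<a} \<times> {0..<b}). f k)"
    by (simp only: im)
  also have "\<dots> = (\<Sum>(x, y)\<in>{0..<a} \<times> {0..<b}. f (x * b + y * a))"
    by (subst sum.reindex[OF inj]) (auto simp: per intro!: sum.cong)
  finally show ?thesis .
qed

text \<open>Passes from the index range of \<open>U_poly\<close> to the standard residues: only the
  representative \<open>d\<close> has to be replaced by 0.\<close>

lemma sum_residues_nat:
  fixes f :: "int \<Rightarrow> 'a::comm_monoid_add"
  assumes per: "\<And>k. f (k mod int d) = f k"
  shows "(\<Sum>k\<in>{1..d}. f (int k)) = (\<Sum>k\<in>{0..<int d}. f k)"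
proof -
  have "f (int d) = f 0"
    using per[of "int d"] by simp
  then show ?thesis
    by (intro sum.reindex_bij_witness[of _ "\<lambda>k. if k = 0 then d else nat k"
          "\<lambda>k. if k = d then 0 else int k"]) auto
qed

section \<open>Additive characters modulo d\<close>

definition unity_root :: "nat \<Rightarrow> int \<Rightarrow> complex" where
  "unity_root d k = cis (2 * pi * (of_int k / of_nat d))"

lemma unity_root_0 [simp]: "unity_root d 0 = 1"
  by (simp add: unity_root_def)

lemma unity_root_add: "unity_root d (k + l) = unity_root d k * unity_root d l"
  by (simp add: unity_root_def cis_mult algebra_simps add_divide_distrib)

lemma unity_root_power: "unity_root d k ^ m = unity_root d (k * int m)"
  by (simp add: unity_root_def DeMoivre mult_ac)

lemma cnj_unity_root: "cnj (unity_root d k) = unity_root d (- k)"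
  by (simp add: unity_root_def cis_cnj)

lemma unity_root_eq_1: 
  assumes "d > 0" and "int d dvd k"
  shows "unity_root d k = 1"
proof -
  obtain j where "k = int d * j"
    using assms by blast
  then show ?thesis
    using assms by (simp add: unity_root_def)
qed

lemma unity_root_cong: 
  assumes "d > 0" and "[k = l] (mod int d)"
  shows "unity_root d k = unity_root d l"
proof -
  have "unity_root d k = unity_root d l * unity_root d (k - l)"
    by (simp flip: unity_root_add)
  also have "unity_root d (k - l) = 1"
    using assms by (intro unity_root_eq_1) (auto simp: cong_iff_dvd_diff)
  finally show ?thesis by simp
qed

lemma unity_root_cancel:
  assumes "a > 0" "b > 0"
  shows "unity_root (a * b) (k * int b) = unity_root a k"
    and "unity_root (a * b) (k * int a) = unity_root b k"
  using assms by (simp_all add: unity_root_def)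

lemma exp_eq_unity_root:
  "exp (2 * of_real pi * \<i> * of_nat k / of_nat d) = unity_root d (int k)"
  by (simp add: unity_root_def cis_conv_exp mult_ac)

lemma unity_root_neq_1:
  assumes "d > 0" and "\<not> int d dvd k"
  shows "unity_root d k \<noteq> 1"
proof
  assume "unity_root d k = 1"
  then have "cos (2 * pi * (of_int k / of_nat d)) = 1"
    by (metis unity_root_def Re_complex_of_real cis.simps(1) one_complex.simps(1))
  then obtain j where "2 * pi * (of_int k / of_nat d) = of_int j * 2 * pi"
    unfolding cos_one_2pi_int by blast
  then have "real_of_int k = of_int (j * int d)"
    using \<open>d > 0\<close> by (simp add: field_simps)
  then show False
    using assms by (metis dvd_triv_right of_int_eq_iff)
qed

text \<open>Orthogonality: if \<open>d\<close> does not divide \<open>k\<close>, this is a geometric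
  sum whose ratio is a \<open>d\<close>-th root of unity other than 1.\<close>

lemma sum_unity_root:
  assumes "d > 0"
  shows "(\<Sum>m\<in>{0..<int d}. unity_root d (k * m)) = (if int d dvd k then of_nat d else 0)"
proof (cases "int d dvd k")
  case True
  then show ?thesis
    using assms by (simp add: unity_root_eq_1)
next
  case False
  have "(\<Sum>m\<in>{0..<int d}. unity_root d (k * m)) = (\<Sum>m<d. unity_root d k ^ m)"
    by (intro sum.reindex_bij_witness[of _ int nat]) (auto simp: unity_root_power)
  also have "\<dots> = (unity_root d k ^ d - 1) / (unity_root d k - 1)"
    using unity_root_neq_1[OF assms False] by (rule geometric_sum)
  also have "unity_root d k ^ d = 1"
    using assms by (simp add: unity_root_power unity_root_eq_1)
  finally show ?thesis
    using False by simp
qed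

section \<open>Ramanujan sums\<close>

text \<open>An indicator in place of a restricted index set makes the lemmas on complete residue
  systems applicable.\<close>

definition ramanujan_sum :: "nat \<Rightarrow> int \<Rightarrow> complex" where
  "ramanujan_sum d m = (\<Sum>k\<in>{0..<int d}. of_bool (coprime k (int d)) * unity_root d (k * m))"

text \<open>Under the Chinese remainder correspondence both the unit condition and the additive
  character factor.\<close>

lemma ramanujan_sum_mult:
  assumes "a > 0" "b > 0" "coprime a b"
  shows "ramanujan_sum (a * b) m = ramanujan_sum a m * ramanujan_sum b m"
proof -
  let ?f = "\<lambda>k. of_bool (coprime k (int a * int b)) * unity_root (a * b) (k * m)"
  have per: "?f (k mod (int a * int b)) = ?f k" for k
  proof -
    have "unity_root (a * b) (k mod (int a * int b) * m) = unity_root (a * b) (k * m)"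
      using assms by (intro unity_root_cong) (auto simp: cong_def mod_mult_left_eq)
    moreover have "coprime (k mod (int a * int b)) (int a * int b) = coprime k (int a * int b)"
      by (metis coprime_iff_gcd_eq_1 gcd.commute gcd_red_int)
    ultimately show ?thesis by simp
  qed
  have ab: "coprime (int a) (int b)"
    using assms by simp
  have c: "coprime (x * int b + y * int a) (int a * int b) 
             \<longleftrightarrow> coprime x (int a) \<and> coprime y (int b)" for x y
  proof -
    have "coprime (x * int b + y * int a) (int a) \<longleftrightarrow> coprime (x * int b) (int a)"
      by (metis add.commute coprime_iff_gcd_eq_1 gcd.commute gcd_add_mult)
    moreover have "coprime (x * int b + y * int a) (int b) \<longleftrightarrow> coprime (y * int a) (int b)"
      by (metis coprime_iff_gcd_eq_1 gcd.commute gcd_add_mult)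
    ultimately show ?thesis
      using ab by (auto simp: coprime_commute)
  qed
  have u: "unity_root (a * b) ((x * int b + y * int a) * m) 
             = unity_root a (x * m) * unity_root b (y * m)" for x y
  proof -
    have "(x * int b + y * int a) * m = x * m * int b + y * m * int a"
      by (simp add: algebra_simps)
    then show ?thesis
      using assms by (simp add: unity_root_add unity_root_cancel)
  qed
  have "ramanujan_sum (a * b) m = (\<Sum>k\<in>{0..<int a * int b}. ?f k)"
    by (simp add: ramanujan_sum_def)
  also have "\<dots> = (\<Sum>(x, y)\<in>{0..<int a} \<times> {0..<int b}. ?f (x * int b + y * int a))"
    using assms ab by (intro sum_residues_crt per) auto
  also have "\<dots> = (\<Sum>(x, y)\<in>{0..<int a} \<times> {0..<int b}.
      (of_bool (coprime x (int a)) * unity_root a (x * m)) *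
      (of_bool (coprime y (int b)) * unity_root b (y * m)))"
    unfolding c u by (intro sum.cong) auto
  also have "\<dots> = ramanujan_sum a m * ramanujan_sum b m"
    unfolding ramanujan_sum_def sum_product sum.cartesian_product ..
  finally show ?thesis .
qed

text \<open>All residues modulo \<open>p\<close> except 0 are units, so this is the complete
  character sum minus its term 1 at 0.\<close>

lemma ramanujan_sum_prime:
  assumes "prime p"
  shows "ramanujan_sum p m = (if int p dvd m then of_nat p - 1 else - 1)"
proof -
  have p: "p > 0"
    using assms prime_gt_0_nat by blast
  have cop: "coprime k (int p) \<longleftrightarrow> k \<noteq> 0" if "k \<in> {0..<int p}" for k
  proof -
    have "coprime k (int p) \<longleftrightarrow> \<not> int p dvd k"
      using assms by (metis coprime_commute prime_imp_coprime_int prime_nat_int_transfer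
          coprime_absorb_left not_prime_unit)
    also have "\<dots> \<longleftrightarrow> k \<noteq> 0"
      using that zdvd_not_zless by fastforce
    finally show ?thesis .
  qed
  have "ramanujan_sum p m = (\<Sum>k\<in>{0..<int p}. of_bool (k \<noteq> 0) * unity_root p (k * m))"
    unfolding ramanujan_sum_def by (intro sum.cong) (auto simp: cop)
  also have "\<dots> = (\<Sum>k\<in>{0..<int p}. unity_root p (m * k) - (if k = 0 then 1 else 0))"
    by (intro sum.cong) (auto simp: mult.commute)
  also have "\<dots> = (\<Sum>k\<in>{0..<int p}. unity_root p (m * k)) - 1"
    using p by (simp add: sum_subtractf)
  finally show ?thesis
    using p by (simp add: sum_unity_root)
qed

lemma coprime_if_squarefree_prime_mult:
  fixes p :: nat
  assumes "prime p" "squarefree (p * d)"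
  shows "coprime p d"
proof (rule prime_imp_coprime[OF \<open>prime p\<close>])
  show "\<not> p dvd d"
  proof
    assume "p dvd d"
    then have "p ^ 2 dvd p * d"
      by (simp add: power2_eq_square)
    then show False
      using assms squarefreeD by (metis not_prime_unit)
  qed
qed

text \<open>Multiplicativity reduces this to primes: a prime factor \<open>p\<close> of
  \<open>d\<close> contributes p - 1 = phi(p) if it divides \<open>m\<close>, and -1 otherwise. The
  sign is left open, since the bounds only require it to be 1 or -1.\<close>

lemma ramanujan_sum_squarefree:
  assumes "squarefree d"
  shows "\<exists>s\<in>{1, -1}. ramanujan_sum d (int m) = s * of_nat (totient (gcd d m))"
  using assms
proof (induction d rule: prime_divisors_induct)
  case (unit d)
  moreover have "{0..<1::int} = {0}"
    by auto
  ultimately show ?case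
    by (simp add: ramanujan_sum_def)
next
  case (factor p d)
  have p: "p > 0" and d: "d > 0"
    using factor prime_gt_0_nat by (auto intro!: Nat.gr0I)
  have cop: "coprime p d"
    using factor by (intro coprime_if_squarefree_prime_mult)
  obtain s where s: "s \<in> {1, -1}" "ramanujan_sum d (int m) = s * of_nat (totient (gcd d m))"
    using factor by (meson squarefree_multD)
  have *: "ramanujan_sum (p * d) (int m) 
        = (if p dvd m then of_nat p - 1 else - 1) * s * of_nat (totient (gcd d m))"
    using p d cop factor by (simp add: ramanujan_sum_mult ramanujan_sum_prime s)
  show ?case
  proof (cases "p dvd m")
    case True
    then obtain j where j: "m = p * j" ..
    have "gcd (p * d) m = p * gcd d m"
      using cop by (simp add: j gcd_mult_left gcd_mult_right_left_cancel coprime_commute)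
    moreover have "coprime p (gcd d m)"
      using cop by (meson coprime_divisors dvd_refl gcd_dvd1)
    ultimately have t: "totient (gcd (p * d) m) = (p - 1) * totient (gcd d m)"
      using factor by (simp add: totient_mult_coprime totient_prime)
    show ?thesis
      using True s p by (intro bexI[of _ s]) (auto simp: * t of_nat_diff)
  next
    case False
    then have "coprime m p"
      using factor by (metis coprime_commute prime_imp_coprime)
    then have "gcd (p * d) m = gcd d m"
      by (rule gcd_mult_left_left_cancel)
    then show ?thesis
      using False s by (intro bexI[of _ "- s"]) (auto simp: *)
  qed
qed simp

section \<open>The Jacobi symbol and its Gauss sum\<close>

lemma Legendre_cong: "[a = b] (mod p) \<Longrightarrow> Legendre a p = Legendre b p"
  by (simp add: Legendre_def QuadRes_def cong_def)

lemma Legendre_1 [simp]: "prime p \<Longrightarrow> Legendre 1 (int p) = 1"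
  unfolding Legendre_def QuadRes_def
  by (metis cong_0_iff cong_refl int_dvd_int_iff not_prime_unit of_nat_1 power_one)

lemma Legendre_values: "Legendre a p \<in> {-1, 0, 1}"
  by (simp add: Legendre_def)

text \<open>Turns Euler's congruence into an equality: values in {-1, 0, 1} differ by at most 2,
  which is less than an odd prime.\<close>

lemma eq_if_dvd_diff_less:
  fixes a b :: int
  assumes "m dvd a - b" "\<bar>a - b\<bar> < m"
  shows "a = b"
  using assms dvd_imp_le_int[of "a - b" m] by fastforce

lemma odd_prime_gt_2:
  fixes p :: nat
  assumes "prime p" "odd p"
  shows "p > 2"
  using assms prime_ge_2_nat[of p] by (metis dvd_refl le_neq_implies_less)

text \<open>By Euler's criterion both sides are congruent modulo \<open>p\<close> to the same power
  of \<open>a * b\<close>.\<close>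

lemma Legendre_mult:
  assumes "prime p" "odd p"
  shows "Legendre (a * b) (int p) = Legendre a (int p) * Legendre b (int p)"
proof -
  have p: "2 < p"
    using assms by (rule odd_prime_gt_2)
  have e: "[Legendre x (int p) = x ^ ((p - 1) div 2)] (mod int p)" for x
    using euler_criterion[OF \<open>prime p\<close> p] .
  have "[Legendre a (int p) * Legendre b (int p) = (a * b) ^ ((p - 1) div 2)] (mod int p)"
    unfolding power_mult_distrib by (rule cong_mult[OF e e])
  then have "int p dvd Legendre (a * b) (int p) - Legendre a (int p) * Legendre b (int p)"
    using cong_trans[OF e[of "a * b"] cong_sym] by (simp add: cong_iff_dvd_diff)
  moreover have "\<bar>Legendre (a * b) (int p) - Legendre a (int p) * Legendre b (int p)\<bar> < int p"
    using p Legendre_values[of a "int p"] Legendre_values[of b "int p"] 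
      Legendre_values[of "a * b" "int p"] by auto
  ultimately show ?thesis
    by (rule eq_if_dvd_diff_less)
qed

text \<open>Otherwise squaring would be onto, hence injective, on the residues modulo
  \<open>p\<close>; but 1 and p - 1 are distinct and have the same square.\<close>

lemma ex_quadratic_nonresidue:
  assumes "prime p" "odd p"
  shows "\<exists>x. Legendre x (int p) = -1"
proof (rule ccontr)
  assume non: "\<nexists>x. Legendre x (int p) = -1"
  have p: "int p > 2"
    using odd_prime_gt_2[OF assms] by simp
  let ?sq = "\<lambda>x. x ^ 2 mod int p"
  have "{0..<int p} \<subseteq> ?sq ` {0..<int p}"
  proof
    fix a assume a: "a \<in> {0..<int p}"
    have "\<exists>y. [y ^ 2 = a] (mod int p)"
    proof (cases "[a = 0] (mod int p)")
      case True
      then show ?thesis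
        by (intro exI[of _ 0]) (simp add: cong_sym)
    next
      case False
      then have "QuadRes (int p) a"
        using non by (auto simp: Legendre_def split: if_splits)
      then show ?thesis
        by (simp add: QuadRes_def)
    qed
    then obtain y where "[y ^ 2 = a] (mod int p)" ..
    then have "a = ?sq (y mod int p)"
      using a by (simp add: cong_def power_mod)
    then show "a \<in> ?sq ` {0..<int p}"
      using p by auto
  qed
  moreover have "?sq ` {0..<int p} \<subseteq> {0..<int p}"
    using p by auto
  ultimately have "inj_on ?sq {0..<int p}"
    by (intro eq_card_imp_inj_on) auto
  moreover have "?sq 1 = ?sq (int p - 1)"
  proof -
    have "(int p - 1) ^ 2 = 1 + (int p - 2) * int p"
      by (simp add: power2_eq_square algebra_simps)
    then show ?thesis
      by (metis mod_mult_self1 power_one)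
  qed
  ultimately have "1 = int p - 1"
    by (rule inj_onD) (use p in auto)
  then show False
    using p by simp
qed

section \<open>The Jacobi symbol\<close>

lemma Jacobi_mult:
  assumes "odd d"
  shows "Jacobi (a * b) d = Jacobi a d * Jacobi b d"
proof -
  have "Legendre (a * b) (int p) = Legendre a (int p) * Legendre b (int p)" 
    if "p \<in># prime_factorization d" for p
    using that assms 
    by (intro Legendre_mult) (auto dest: in_prime_factors_imp_dvd dvd_trans)
  then show ?thesis
    unfolding Jacobi_def by (subst prod_mset.distrib[symmetric]) (simp cong: image_mset_cong)
qed

lemma Jacobi_mult_right:
  assumes "a > 0" "b > 0"
  shows "Jacobi k (a * b) = Jacobi k a * Jacobi k b"
  using assms by (simp add: Jacobi_def prime_factorization_mult)

lemma Jacobi_prime: "prime p \<Longrightarrow> Jacobi k p = Legendre k (int p)"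
  by (simp add: Jacobi_def prime_factorization_prime)

lemma Jacobi_1 [simp]: "Jacobi 1 d = 1"
  unfolding Jacobi_def by (simp add: in_prime_factors_imp_prime cong: image_mset_cong)

lemma Jacobi_cong: 
  assumes "[a = b] (mod int d)"
  shows "Jacobi a d = Jacobi b d"
proof -
  have "Legendre a (int p) = Legendre b (int p)" if "p \<in># prime_factorization d" for p
    using that assms
    by (intro Legendre_cong cong_dvd_modulus[OF assms]) (auto dest: in_prime_factors_imp_dvd)
  then show ?thesis
    by (simp add: Jacobi_def cong: image_mset_cong)
qed

lemma Jacobi_mod [simp]: "Jacobi (k mod int d) d = Jacobi k d"
  by (rule Jacobi_cong) (simp add: cong_def)

lemma zdvd_nat_abs_iff: "n dvd nat \<bar>k\<bar> \<longleftrightarrow> int n dvd k"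
  by (metis dvd_abs_iff int_dvd_int_iff nat_0_le abs_ge_zero)

lemma Jacobi_eq_0_iff:
  assumes "d > 0"
  shows "Jacobi k d = 0 \<longleftrightarrow> \<not> coprime k (int d)"
proof -
  have "Jacobi k d = 0 \<longleftrightarrow> (\<exists>p\<in>prime_factors d. Legendre k (int p) = 0)"
    by (auto simp: Jacobi_def prod_mset_zero_iff)
  also have "\<dots> \<longleftrightarrow> (\<exists>p. prime p \<and> p dvd d \<and> int p dvd k)"
    using assms by (auto simp: Legendre_def cong_0_iff prime_factors_dvd)
  \<comment> \<open>The absolute value moves the question to natural numbers, where a gcd other than
    1 has a prime factor.\<close>
  also have "\<dots> \<longleftrightarrow> \<not> coprime (nat \<bar>k\<bar>) d"
  proof
    assume "\<exists>p. prime p \<and> p dvd d \<and> int p dvd k"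
    then show "\<not> coprime (nat \<bar>k\<bar>) d"
      by (metis coprime_common_divisor int_dvd_int_iff zdvd_nat_abs_iff not_prime_unit)
  next
    assume "\<not> coprime (nat \<bar>k\<bar>) d"
    then have "gcd (nat \<bar>k\<bar>) d \<noteq> 1"
      by (simp add: coprime_iff_gcd_eq_1)
    then obtain p where "prime p" "p dvd gcd (nat \<bar>k\<bar>) d"
      using prime_factor_nat by blast
    then show "\<exists>p. prime p \<and> p dvd d \<and> int p dvd k"
      by (meson gcd_dvd1 gcd_dvd2 dvd_trans zdvd_nat_abs_iff)
  qed
  also have "\<dots> \<longleftrightarrow> \<not> coprime k (int d)"
    using coprime_int_iff[of "nat \<bar>k\<bar>" d] by simp
  finally show ?thesis .
qed

lemma Jacobi_values: "Jacobi k d \<in> {-1, 0, 1}"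
proof -
  have "prod_mset (image_mset (\<lambda>p. Legendre k (int p)) A) \<in> {-1, 0, 1}" for A
  proof (induction A)
    case (add p A)
    then show ?case
      using Legendre_values[of k "int p"] by auto
  qed simp
  then show ?thesis
    by (simp add: Jacobi_def)
qed

text \<open>By the Chinese remainder theorem \<open>k\<close> can be a nonresidue modulo
  \<open>p\<close> and 1 modulo \<open>d div p\<close>. Such a \<open>k\<close> fixes every multiple
  of \<open>p\<close> modulo \<open>d\<close> but reverses the sign of the symbol, which forces
  Gauss sums at non-units to vanish.\<close>

lemma ex_Jacobi_eq_neg1:
  assumes "squarefree d" "odd d" "prime p" "p dvd d"
  shows "\<exists>k. coprime k (int d) \<and> [k = 1] (mod int (d div p)) \<and> Jacobi k d = -1"
proof -
  obtain e where d: "d = p * e"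
    using assms by blast
  have pos: "p > 0" "e > 0"
    using assms by (auto simp: d intro!: Nat.gr0I)
  have "coprime (int p) (int e)"
    using assms coprime_if_squarefree_prime_mult d by simp
  moreover obtain x where x: "Legendre x (int p) = -1"
    using ex_quadratic_nonresidue assms by (meson dvd_trans)
  ultimately obtain k where k: "[k = x] (mod int p)" "[k = 1] (mod int e)"
    using binary_chinese_remainder_int by blast
  have "Jacobi k d = Legendre k (int p) * Jacobi k e"
    using pos assms by (simp add: d Jacobi_mult_right Jacobi_prime)
  also have "\<dots> = -1"
    using Legendre_cong[OF k(1)] Jacobi_cong[OF k(2)] x by simp
  finally have "Jacobi k d = -1" .
  moreover from this have "coprime k (int d)"
    using Jacobi_eq_0_iff[of d k] pos d by fastforce
  moreover have "d div p = e"
    using d pos by simp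
  ultimately show ?thesis
    using k by auto
qed

text \<open>The congruence of (-1/d) and d modulo 4 is multiplicative in d, unlike the exponent
  \<open>(d - 1) div 2\<close>, and at primes it is Euler's criterion. Since -1, 0, 1 are distinct
  modulo 4, it determines the symbol.\<close>

lemma Jacobi_neg1:
  assumes "odd d"
  shows "Jacobi (-1) d = (-1) ^ ((d - 1) div 2)"
proof -
  have "[Jacobi (-1) d = int d] (mod 4)"
    using assms
  proof (induction d rule: prime_divisors_induct)
    case (unit d)
    then show ?case by (simp add: Jacobi_def)
  next
    case (factor p d)
    have pos: "p > 0" "d > 0"
      using factor by (auto intro!: Nat.gr0I)
    have p: "p > 2"
      using factor odd_prime_gt_2 by simp
    have neg: "[x ^ ((p - 1) div 2) = int p] (mod 4)" if "x = -1" for x :: int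
    proof -
      have "p mod 4 = 1 \<or> p mod 4 = 3"
        using factor.prems by simp presburger
      then show ?thesis
      proof
        assume "p mod 4 = 1"
        then obtain j where "p = 4 * j + 1"
          by (metis mult_div_mod_eq)
        then show ?thesis
          using that by (simp add: cong_def)
      next
        assume "p mod 4 = 3"
        then obtain j where j: "p = 4 * j + 3"
          by (metis mult_div_mod_eq)
        then have "(p - 1) div 2 = Suc (2 * j)"
          by simp
        then show ?thesis
          using that j by (simp add: cong_def)
      qed
    qed
    have "int p dvd Legendre (-1) (int p) - (-1) ^ ((p - 1) div 2)"
      using euler_criterion[of p "-1"] factor p by (simp add: cong_iff_dvd_diff)
    moreover have "\<bar>Legendre (-1) (int p) - (-1) ^ ((p - 1) div 2)\<bar> < int p"
      using p Legendre_values[of "-1" "int p"]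
      by (cases "even ((p - 1) div 2)") auto
    ultimately have "Legendre (-1) (int p) = (-1) ^ ((p - 1) div 2)"
      by (rule eq_if_dvd_diff_less)
    then have "[Legendre (-1) (int p) = int p] (mod 4)"
      using neg by simp
    moreover have "[Jacobi (-1) d = int d] (mod 4)"
      using factor by simp
    ultimately show ?case
      using factor pos by (simp add: Jacobi_mult_right Jacobi_prime cong_mult)
  qed simp
  then show ?thesis
  proof -
    assume c: "[Jacobi (-1) d = int d] (mod 4)"
    have "d mod 4 = 1 \<or> d mod 4 = 3"
      using assms by presburger
    then show ?thesis
    proof
      assume d: "d mod 4 = 1"
      then obtain j where "d = 4 * j + 1"
        by (metis mult_div_mod_eq)
      then show ?thesis
        using c Jacobi_values[of "-1" d] by (auto simp: cong_def)
    next
      assume "d mod 4 = 3"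
      then obtain j where j: "d = 4 * j + 3"
        by (metis mult_div_mod_eq)
      then have "(d - 1) div 2 = Suc (2 * j)"
        by simp
      then show ?thesis
        using c j Jacobi_values[of "-1" d] by (auto simp: cong_def)
    qed
  qed
qed

section \<open>Gauss sums of the Jacobi symbol\<close>

definition gauss_sum :: "nat \<Rightarrow> int \<Rightarrow> complex" where
  "gauss_sum d m = (\<Sum>k\<in>{0..<int d}. of_int (Jacobi k d) * unity_root d (k * m))"

lemma gauss_sum_cong:
  assumes "d > 0" "[m = m'] (mod int d)"
  shows "gauss_sum d m = gauss_sum d m'"
  unfolding gauss_sum_def
  by (intro sum.cong refl arg_cong2[where f = "(*)"] unity_root_cong cong_scalar_left assms)

text \<open>Substitute \<open>u * k\<close> for \<open>k\<close> in the sum over all residues and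
  pull out the symbol of \<open>u\<close>.\<close>

lemma gauss_sum_twist:
  assumes "odd d" "coprime u (int d)"
  shows "gauss_sum d m = of_int (Jacobi u d) * gauss_sum d (u * m)"
proof -
  let ?f = "\<lambda>k. of_int (Jacobi k d) * unity_root d (k * m)"
  have d: "d > 0"
    using assms by (auto intro!: Nat.gr0I)
  have per: "?f (k mod int d) = ?f k" for k
  proof -
    have "unity_root d (k mod int d * m) = unity_root d (k * m)"
      using d by (intro unity_root_cong) (auto simp: cong_def mod_mult_left_eq)
    then show ?thesis by simp
  qed
  have "gauss_sum d m = (\<Sum>k\<in>{0..<int d}. ?f (u * k))"
    unfolding gauss_sum_def using d assms by (intro sum_residues_mult[symmetric] per) auto
  also have "\<dots> = of_int (Jacobi u d) * gauss_sum d (u * m)"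
    unfolding gauss_sum_def sum_distrib_left
    by (intro sum.cong) (auto simp: Jacobi_mult[OF \<open>odd d\<close>] mult_ac)
  finally show ?thesis .
qed

text \<open>At a unit \<open>m\<close>, this is the twist by \<open>m\<close> of the sum at 1. At a
  non-unit, a twist that fixes \<open>m\<close> and has symbol -1 shows that the sum equals its
  negative.\<close>

lemma gauss_sum_primitive:
  assumes "squarefree d" "odd d"
  shows "gauss_sum d m = of_int (Jacobi m d) * gauss_sum d 1"
proof (cases "coprime m (int d)")
  case True
  have d: "d > 0"
    using assms by (auto intro!: Nat.gr0I)
  have "Jacobi m d \<noteq> 0"
    using True d by (simp add: Jacobi_eq_0_iff)
  then have "Jacobi m d \<in> {1, -1}"
    using Jacobi_values[of m d] by auto
  then show ?thesis
    using gauss_sum_twist[OF \<open>odd d\<close> True, of 1] by auto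
next
  case False
  have d: "d > 0"
    using assms by (auto intro!: Nat.gr0I)
  have "gcd (nat \<bar>m\<bar>) d \<noteq> 1"
    using False coprime_int_iff[of "nat \<bar>m\<bar>" d] by (simp add: coprime_iff_gcd_eq_1)
  then obtain p where p: "prime p" "p dvd gcd (nat \<bar>m\<bar>) d"
    using prime_factor_nat by blast
  then have pd: "p dvd d" "int p dvd m"
    unfolding gcd_greatest_iff zdvd_nat_abs_iff by blast+
  obtain k where k: "coprime k (int d)" "[k = 1] (mod int (d div p))" "Jacobi k d = -1"
    using ex_Jacobi_eq_neg1[OF assms p(1) pd(1)] by blast
  \<comment> \<open>Here \<open>p\<close> divides \<open>m\<close> and \<open>d div p\<close>
    divides k - 1, so multiplication by \<open>k\<close> fixes \<open>m\<close> modulo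
    \<open>d\<close>.\<close>
  have "int p * int (d div p) dvd m * (k - 1)"
    using pd k(2) by (intro mult_dvd_mono) (auto simp: cong_iff_dvd_diff)
  moreover have "int p * int (d div p) = int d"
    using pd by (metis dvd_mult_div_cancel of_nat_mult)
  ultimately have "[k * m = m] (mod int d)"
    by (simp add: cong_iff_dvd_diff algebra_simps)
  then have "gauss_sum d m = - gauss_sum d m"
    using gauss_sum_twist[OF \<open>odd d\<close> k(1), of m] k(3) gauss_sum_cong[OF d] by simp
  then have "gauss_sum d m = 0"
    by simp
  then show ?thesis
    using False d by (simp add: Jacobi_eq_0_iff)
qed

text \<open>Conjugation negates the exponent and so evaluates the sum at -1. With
  \<open>Jacobi_neg1\<close> this makes the Gauss sum purely imaginary when d is 3 modulo 4.\<close>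

lemma cnj_gauss_sum:
  assumes "squarefree d" "odd d"
  shows "cnj (gauss_sum d 1) = of_int (Jacobi (-1) d) * gauss_sum d 1"
proof -
  have "cnj (gauss_sum d 1) = gauss_sum d (-1)"
    by (simp add: gauss_sum_def cnj_unity_root)
  then show ?thesis
    using gauss_sum_primitive[OF assms, of "-1"] by simp
qed

text \<open>Parseval's identity for \<open>m \<mapsto> gauss_sum d m\<close>, whose modulus is constant on the units
  and zero elsewhere, determines that modulus.\<close>

lemma cmod_gauss_sum:
  assumes "squarefree d" "odd d" "d > 1"
  shows "cmod (gauss_sum d 1) = sqrt (real d)"
proof -
  let ?R = "{0..<int d}"
  let ?J = "\<lambda>k. complex_of_int (Jacobi k d)"
  let ?N = "(\<Sum>k\<in>?R. ?J k ^ 2)"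
  define \<tau> where "\<tau> = gauss_sum d 1"
  have "(\<Sum>m\<in>?R. gauss_sum d m * cnj (gauss_sum d m))
      = (\<Sum>m\<in>?R. \<Sum>k\<in>?R. \<Sum>l\<in>?R. ?J k * ?J l * unity_root d ((k - l) * m))"
    unfolding gauss_sum_def cnj_sum sum_product
  proof (intro sum.cong refl)
    fix m k l
    have "unity_root d ((k - l) * m) = unity_root d (k * m) * cnj (unity_root d (l * m))"
      unfolding cnj_unity_root unity_root_add[symmetric] by (simp add: algebra_simps)
    then show "?J k * unity_root d (k * m) * cnj (?J l * unity_root d (l * m))
        = ?J k * ?J l * unity_root d ((k - l) * m)"
      by simp
  qed
  \<comment> \<open>The sum over \<open>m\<close> moves inside, where orthogonality will leave only
    the diagonal.\<close>
  also have "\<dots> = (\<Sum>k\<in>?R. \<Sum>l\<in>?R. \<Sum>m\<in>?R. ?J k * ?J l * unity_root d ((k - l) * m))"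
    by (subst sum.swap, rule sum.cong[OF refl], rule sum.swap)
  also have "\<dots> = (\<Sum>k\<in>?R. \<Sum>l\<in>?R. if l = k then of_nat d * ?J k ^ 2 else 0)"
  proof (intro sum.cong refl)
    fix k l assume kl: "k \<in> ?R" "l \<in> ?R"
    then have "int d dvd k - l \<longleftrightarrow> l = k"
      by (auto simp: mod_eq_dvd_iff[symmetric])
    moreover have "(\<Sum>m\<in>?R. ?J k * ?J l * unity_root d ((k - l) * m))
        = ?J k * ?J l * (\<Sum>m\<in>?R. unity_root d ((k - l) * m))"
      by (simp add: sum_distrib_left)
    ultimately show "(\<Sum>m\<in>?R. ?J k * ?J l * unity_root d ((k - l) * m))
        = (if l = k then of_nat d * ?J k ^ 2 else 0)"
      using assms by (simp add: sum_unity_root power2_eq_square)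
  qed
  also have "\<dots> = of_nat d * ?N"
    by (simp add: sum_distrib_left)
  finally have "(\<Sum>m\<in>?R. gauss_sum d m * cnj (gauss_sum d m)) = of_nat d * ?N" .
  moreover have "(\<Sum>m\<in>?R. gauss_sum d m * cnj (gauss_sum d m)) = (\<Sum>m\<in>?R. ?J m ^ 2) * (\<tau> * cnj \<tau>)"
    unfolding sum_distrib_right
  proof (intro sum.cong refl)
    fix m
    show "gauss_sum d m * cnj (gauss_sum d m) = ?J m ^ 2 * (\<tau> * cnj \<tau>)"
      unfolding gauss_sum_primitive[OF assms(1,2), of m] \<tau>_def
      by (simp add: power2_eq_square mult_ac)
  qed
  ultimately have "?N * (\<tau> * cnj \<tau>) = ?N * of_nat d"
    by (simp add: mult.commute)
  \<comment> \<open>\<open>?N\<close> counts the units modulo \<open>d\<close>. The residue 1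
    contributes to it, and lies in \<open>?R\<close> because d > 1.\<close>
  moreover have "?N \<noteq> 0"
  proof -
    have "Jacobi 1 d ^ 2 \<le> (\<Sum>k\<in>?R. Jacobi k d ^ 2)"
      using assms by (intro member_le_sum) auto
    then have "(\<Sum>k\<in>?R. Jacobi k d ^ 2) \<noteq> 0"
      by simp
    then have "complex_of_int (\<Sum>k\<in>?R. Jacobi k d ^ 2) \<noteq> 0"
      by (simp only: of_int_eq_0_iff not_False_eq_True)
    then show ?thesis
      by simp
  qed
  ultimately have "\<tau> * cnj \<tau> = of_nat d"
    by simp
  then have "complex_of_real (cmod \<tau> ^ 2) = complex_of_real (real d)"
    by (simp only: complex_norm_square of_real_of_nat_eq)
  then have "cmod \<tau> ^ 2 = real d"
    by (simp only: of_real_eq_iff)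
  then show ?thesis
    unfolding \<tau>_def by (metis norm_ge_zero real_sqrt_unique)
qed

lemma cmod_sqrt_discr: "cmod (sqrt_discr d) = sqrt (real d)"
  by (simp add: sqrt_discr_def norm_mult)

text \<open>The sign of the Gauss sum is avoided. For d = 1 modulo 4 the right side is 1 + sqrt d,
  so the triangle inequality suffices; for d = 3 modulo 4 the Gauss sum is purely imaginary, and
  both sides are sqrt (1 + d) for any signs.\<close>

lemma cmod_unit_add_gauss_sum_le:
  assumes "squarefree d" "odd d" "d > 1" "a \<in> {1, -1}" "b \<in> {1, -1}"
  shows "cmod (a + b * gauss_sum d 1) \<le> cmod (1 + sqrt_discr d)"
proof (cases "d mod 4 = 1")
  case True
  have "cmod (a + b * gauss_sum d 1) \<le> cmod a + cmod (b * gauss_sum d 1)"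
    by (rule norm_triangle_ineq)
  also have "\<dots> = 1 + sqrt (real d)"
    using assms by (auto simp: cmod_gauss_sum norm_mult)
  also have "\<dots> = cmod (of_real (1 + sqrt (real d)))"
    by (simp only: norm_of_real) simp
  finally show ?thesis
    using True by (simp add: sqrt_discr_def)
next
  case False
  then have "d mod 4 = 3"
    using \<open>odd d\<close> by presburger
  then obtain j where j: "d = 4 * j + 3"
    by (metis mult_div_mod_eq)
  then have "(d - 1) div 2 = Suc (2 * j)"
    by simp
  then have "Jacobi (-1) d = -1"
    using assms by (simp add: Jacobi_neg1)
  then have "cnj (gauss_sum d 1) = - gauss_sum d 1"
    using assms by (simp add: cnj_gauss_sum)
  then have "Re (gauss_sum d 1) = 0"
    by (metis cnj.sel(1) neg_equal_zero uminus_complex.sel(1))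
  moreover have "Im (gauss_sum d 1) ^ 2 = real d"
    using cmod_gauss_sum[OF assms(1-3)] cmod_power2[of "gauss_sum d 1"] calculation by simp
  ultimately show ?thesis
    using assms False by (auto simp: cmod_def sqrt_discr_def)
qed

section \<open>Newton's identities and a majorant\<close>

text \<open>Newton's identities from the logarithmic derivative: for R = prod (1 - x_k X) one has R'
  = - R * sum x_k / (1 - x_k X), and the coefficients at X^n are compared.\<close>

lemma newton_identity:
  fixes x :: "'a \<Rightarrow> complex"
  assumes "finite S"
  defines "r \<equiv> Polynomial.coeff (reflect_poly (\<Prod>k\<in>S. [:- x k, 1:]))"
  shows "of_nat (Suc n) * r (Suc n) = - (\<Sum>j\<le>n. (\<Sum>k\<in>S. x k ^ Suc j) * r (n - j))"
proof -
  define R where "R = fps_of_poly (reflect_poly (\<Prod>k\<in>S. [:- x k, 1:]))"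
  \<comment> \<open>The geometric series x_k / (1 - x_k X). Its numerator shifts the exponent, so
    index \<open>j\<close> carries the power sum of order j + 1.\<close>
  define q where "q k = Abs_fps (\<lambda>j. x k ^ Suc j)" for k
  have R: "R = (\<Prod>k\<in>S. 1 - fps_const (x k) * fps_X)"
  proof -
    have "fps_of_poly (reflect_poly [:- y, 1:]) = 1 - fps_const y * fps_X" for y :: complex
      by (simp add: reflect_poly_def fps_of_poly_pCons fps_of_poly_const algebra_simps
               flip: fps_const_neg)
    then show ?thesis
      by (simp only: R_def reflect_poly_prod fps_of_poly_prod)
  qed
  have q: "(1 - fps_const (x k) * fps_X) * q k = fps_const (x k)" for k
  proof (rule fps_ext)
    fix n
    show "((1 - fps_const (x k) * fps_X) * q k) $ n = fps_const (x k) $ n"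
      by (cases n) (simp_all add: left_diff_distrib mult.assoc q_def)
  qed
  have "fps_deriv R = - (R * (\<Sum>k\<in>S. q k))"
    unfolding R using \<open>finite S\<close>
  proof (induction S)
    case (insert k S)
    let ?f = "\<lambda>k. 1 - fps_const (x k) * fps_X"
    have "fps_deriv (\<Prod>k\<in>insert k S. ?f k) 
        = ?f k * fps_deriv (\<Prod>k\<in>S. ?f k) - fps_const (x k) * (\<Prod>k\<in>S. ?f k)"
      using insert.hyps by (simp flip: fps_const_neg)
    also have "\<dots> = - (?f k * (\<Prod>k\<in>S. ?f k) * (\<Sum>k\<in>S. q k)) - ?f k * q k * (\<Prod>k\<in>S. ?f k)"
      by (simp only: insert.IH q) simp
    also have "\<dots> = - ((\<Prod>k\<in>insert k S. ?f k) * (\<Sum>k\<in>insert k S. q k))"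
      using insert.hyps by (simp add: algebra_simps)
    finally show ?case .
  qed simp
  then have "fps_deriv R $ n = - (((\<Sum>k\<in>S. q k) * R) $ n)"
    by (simp add: mult.commute)
  then show ?thesis
    by (simp add: fps_mult_nth R_def r_def q_def fps_sum_nth atLeast0AtMost)
qed

text \<open>The coefficients of C (1 - X)^(-F) satisfy the same recursion with equality, and F \<ge>
  0 carries the comparison through the induction. The cutoff \<open>n\<close> is needed because
  \<open>F_max d n\<close> and \<open>G_max d n\<close> bound the power sums only up to order
  \<open>n\<close>.\<close>

lemma rising_factorial_majorant:
  fixes w :: "nat \<Rightarrow> real"
  assumes "F \<ge> 0" "w 0 \<le> C"
    and step: "\<And>m. m < n \<Longrightarrow> real (Suc m) * w (Suc m) \<le> F * (\<Sum>j\<le>m. w j)"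
    and "m \<le> n"
  shows "w m \<le> C * (\<Prod>i<m. F + real i) / fact m"
proof -
  define h where "h m = C * (\<Prod>i<m. F + real i) / fact m" for m
  have h_Suc: "real (Suc m) * h (Suc m) = (F + real m) * h m" for m
    by (simp add: h_def mult_ac del: of_nat_Suc)
  \<comment> \<open>Coefficient form of the differential equation H' = F H / (1 - X) for H = C (1 -
    X)^(-F).\<close>
  have h: "F * (\<Sum>j\<le>m. h j) = real (Suc m) * h (Suc m)" for m
  proof (induction m)
    case 0
    then show ?case by (simp add: h_def)
  next
    case (Suc m)
    have "F * (\<Sum>j\<le>Suc m. h j) = real (Suc m) * h (Suc m) + F * h (Suc m)"
      by (simp only: sum.atMost_Suc distrib_left Suc.IH)
    also have "\<dots> = (F + real (Suc m)) * h (Suc m)"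
      by (simp add: algebra_simps)
    finally show ?case
      by (simp only: h_Suc)
  qed
  have "w m \<le> h m"
    using \<open>m \<le> n\<close>
  proof (induction m rule: less_induct)
    case (less m)
    show ?case
    proof (cases m)
      case 0
      then show ?thesis
        using \<open>w 0 \<le> C\<close> by (simp add: h_def)
    next
      case (Suc l)
      have "real (Suc l) * w (Suc l) \<le> F * (\<Sum>j\<le>l. w j)"
        using less.prems Suc by (intro step) simp
      also have "\<dots> \<le> F * (\<Sum>j\<le>l. h j)"
        using less Suc \<open>F \<ge> 0\<close> by (intro mult_left_mono sum_mono) auto
      also have "\<dots> = real (Suc l) * h (Suc l)"
        by (rule h)
      finally show ?thesis
        by (simp add: Suc)
    qed
  qed
  then show ?thesis
    by (simp add: h_def)
qed

section \<open>The coefficients of the two factors\<close>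

lemma sum_Jacobi_eq_gauss_sum:
  assumes "d > 0"
  shows "(\<Sum>k\<in>{1..d}. of_int (Jacobi (int k) d) * unity_root d (int k * m)) = gauss_sum d m"
proof -
  let ?f = "\<lambda>k. of_int (Jacobi k d) * unity_root d (k * m)"
  have "?f (k mod int d) = ?f k" for k
  proof -
    have "unity_root d (k mod int d * m) = unity_root d (k * m)"
      using assms by (intro unity_root_cong) (auto simp: cong_def mod_mult_left_eq)
    then show ?thesis by simp
  qed
  from sum_residues_nat[of ?f d, OF this] show ?thesis
    unfolding gauss_sum_def .
qed

lemma sum_coprime_eq_ramanujan_sum:
  assumes "d > 0"
  shows "(\<Sum>k\<in>{1..d}. of_bool (coprime k d) * unity_root d (int k * m)) = ramanujan_sum d m"
proof -
  let ?f = "\<lambda>k. of_bool (coprime k (int d)) * unity_root d (k * m)"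
  have "?f (k mod int d) = ?f k" for k
  proof -
    have "unity_root d (k mod int d * m) = unity_root d (k * m)"
      using assms by (intro unity_root_cong) (auto simp: cong_def mod_mult_left_eq)
    moreover have "coprime (k mod int d) (int d) = coprime k (int d)"
      by (metis coprime_iff_gcd_eq_1 gcd.commute gcd_red_int)
    ultimately show ?thesis by simp
  qed
  from sum_residues_nat[of ?f d, OF this] show ?thesis
    unfolding ramanujan_sum_def by simp
qed

definition Jacobi_class :: "int \<Rightarrow> nat \<Rightarrow> nat set" where
  "Jacobi_class s d = {k. 1 \<le> k \<and> k \<le> d \<and> Jacobi (int k) d = s}"

lemma finite_Jacobi_class [simp]: "finite (Jacobi_class s d)"
  by (rule finite_subset[of _ "{1..d}"]) (auto simp: Jacobi_class_def)

lemma U_poly_eq: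
  "U_poly s d = (\<Prod>k\<in>Jacobi_class s d. [:- unity_root d (int k), 1:])"
  by (simp add: U_poly_def Jacobi_class_def exp_eq_unity_root)

text \<open>On residues, the indicator of symbol \<open>s\<close> is half the sum of the indicator
  of the units and \<open>s\<close> times the symbol.\<close>

lemma sum_Jacobi_class:
  assumes "d > 0" "s \<in> {1, -1}"
  shows "(\<Sum>k\<in>Jacobi_class s d. unity_root d (int k * m))
    = (ramanujan_sum d m + of_int s * gauss_sum d m) / 2"
proof -
  have ind: "(if Jacobi (int k) d = s then 1 else 0)
      = (of_bool (coprime k d) + of_int s * of_int (Jacobi (int k) d)) / (2::complex)" for k
    using assms Jacobi_values[of "int k" d] Jacobi_eq_0_iff[of d "int k"] by auto
  have "(\<Sum>k\<in>Jacobi_class s d. unity_root d (int k * m))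
      = (\<Sum>k\<in>{1..d}. (if Jacobi (int k) d = s then 1 else 0) * unity_root d (int k * m))"
    by (rule sum.mono_neutral_cong_left) (auto simp: Jacobi_class_def)
  also have "\<dots> = (\<Sum>k\<in>{1..d}. of_bool (coprime k d) * unity_root d (int k * m) / 2
      + of_int s * (of_int (Jacobi (int k) d) * unity_root d (int k * m)) / 2)"
    unfolding ind by (intro sum.cong refl) (simp add: field_simps)
  also have "\<dots> = (ramanujan_sum d m + of_int s * gauss_sum d m) / 2"
    unfolding sum.distrib sum_divide_distrib[symmetric] sum_distrib_left[symmetric]
      sum_Jacobi_eq_gauss_sum[OF \<open>d > 0\<close>] sum_coprime_eq_ramanujan_sum[OF \<open>d > 0\<close>]
    by (simp add: add_divide_distrib)
  finally show ?thesis .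
qed

text \<open>The power sum of order 0 counts the class. The Gauss sum at 0 vanishes because 0 is not
  a unit for d > 1, and the Ramanujan sum at 0 is phi(d).\<close>

lemma card_Jacobi_class:
  assumes "squarefree d" "odd d" "d > 1" "s \<in> {1, -1}"
  shows "card (Jacobi_class s d) = totient d div 2"
proof -
  have "gauss_sum d 0 = 0"
    using assms gauss_sum_primitive[of d 0] Jacobi_eq_0_iff[of d 0] by auto
  then have "complex_of_nat (card (Jacobi_class s d)) = ramanujan_sum d 0 / 2"
    using sum_Jacobi_class[of d s 0] assms by simp
  also have "ramanujan_sum d 0 = of_nat (totient d)"
  proof -
    have "ramanujan_sum d 0 = (\<Sum>k\<in>{1..d}. of_bool (coprime k d))"
      using sum_coprime_eq_ramanujan_sum[of d 0] assms by simp
    also have "\<dots> = of_nat (card {k \<in> {1..d}. coprime k d})"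
      by (simp add: of_bool_def sum.If_cases Int_def)
    also have "{k \<in> {1..d}. coprime k d} = totatives d"
      by (auto simp: totatives_def)
    finally show ?thesis
      by (simp add: totient_def)
  qed
  finally have "complex_of_nat (2 * card (Jacobi_class s d)) = of_nat (totient d)"
    by (simp add: mult.commute)
  then have "2 * card (Jacobi_class s d) = totient d"
    by (simp only: of_nat_eq_iff)
  then show ?thesis
    by simp
qed

text \<open>Up to the sign (-1)^n, the elementary symmetric functions of the roots. Reversal numbers
  the coefficients from the top as in \<open>a_coeff\<close> and \<open>b_coeff\<close>, with 0
  beyond the degree.\<close>

definition rev_coeff :: "int \<Rightarrow> nat \<Rightarrow> nat \<Rightarrow> complex" where
  "rev_coeff s d = Polynomial.coeff (reflect_poly (U_poly s d))"

lemma degree_U_poly: "Polynomial.degree (U_poly s d) = card (Jacobi_class s d)"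
  unfolding U_poly_eq by (subst degree_prod_eq_sum_degree) auto

lemma rev_coeff_0: "rev_coeff s d 0 = 1"
proof -
  have "Polynomial.lead_coeff (U_poly s d) = 1"
    unfolding U_poly_eq lead_coeff_prod by simp
  then show ?thesis
    by (simp add: rev_coeff_def)
qed

lemma rev_coeff_eq:
  assumes "squarefree d" "odd d" "d > 1" "s \<in> {1, -1}" "n \<le> totient d div 2"
  shows "Polynomial.coeff (U_poly s d) (totient d div 2 - n) = rev_coeff s d n"
  using assms by (simp add: rev_coeff_def coeff_reflect_poly degree_U_poly card_Jacobi_class)

lemma rev_coeff_Suc:
  assumes "d > 0" "s \<in> {1, -1}"
  shows "of_nat (Suc n) * rev_coeff s d (Suc n) 
    = - (\<Sum>j\<le>n. (ramanujan_sum d (int (Suc j)) + of_int s * gauss_sum d (int (Suc j))) / 2 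
          * rev_coeff s d (n - j))"
  unfolding rev_coeff_def U_poly_eq newton_identity[OF finite_Jacobi_class] unity_root_power
    sum_Jacobi_class[OF assms] ..

lemma a_coeff_eq:
  assumes "squarefree d" "odd d" "d > 1" "n \<le> totient d div 2"
  shows "a_coeff d n = rev_coeff 1 d n + rev_coeff (-1) d n"
  using assms by (simp add: a_coeff_def Psi_poly_def rev_coeff_eq)

text \<open>The convention that \<open>b_coeff\<close> is 0 at index 0 fits, because both factors
  are monic of the same degree.\<close>

lemma b_coeff_mult_sqrt_discr:
  assumes "squarefree d" "odd d" "d > 1" "n \<le> totient d div 2"
  shows "b_coeff d n * sqrt_discr d = rev_coeff (-1) d n - rev_coeff 1 d n"
proof -
  have "sqrt_discr d \<noteq> 0"
    using assms by (simp add: sqrt_discr_def)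
  then show ?thesis
    using assms by (simp add: b_coeff_def Xi_poly_def rev_coeff_eq rev_coeff_0)
qed

text \<open>Split by \<open>gcd d m\<close>. A gcd above 1 is the divisor \<open>f\<close>, at most
  \<open>n\<close> since 1 \<le> m \<le> n; gcd 1 leaves only signs. The cases match the two kinds
  of elements in the maxima F and G.\<close>

lemma power_sum_cases:
  assumes "squarefree d" "odd d" "d > 1" "1 \<le> m" "m \<le> n"
  obtains (divisor) f where "f dvd d" "1 < f" "f \<le> n" 
      "cmod (ramanujan_sum d (int m)) = real (totient f)" "gauss_sum d (int m) = 0"
  | (unit) a b where "a \<in> {1, -1}" "b \<in> {1, -1}" 
      "ramanujan_sum d (int m) = a" "gauss_sum d (int m) = b * gauss_sum d 1"
proof -
  obtain a where a: "a \<in> {1, -1}" "ramanujan_sum d (int m) = a * of_nat (totient (gcd d m))"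
    using ramanujan_sum_squarefree[OF assms(1)] by blast
  have "Jacobi (int m) d = 0 \<longleftrightarrow> \<not> coprime d m"
    using Jacobi_eq_0_iff[of d "int m"] assms by (simp add: coprime_commute)
  then have J: "Jacobi (int m) d = 0 \<longleftrightarrow> gcd d m \<noteq> 1"
    unfolding coprime_iff_gcd_eq_1 .
  show ?thesis
  proof (cases "gcd d m = 1")
    case True
    then have "Jacobi (int m) d \<in> {1, -1}"
      using J Jacobi_values[of "int m" d] by auto
    then show ?thesis
      using a True unit[of a "of_int (Jacobi (int m) d)"] gauss_sum_primitive[OF assms(1,2), of "int m"]
      by auto
  next
    case False
    show ?thesis
    proof (rule divisor[of "gcd d m"])
      show "1 < gcd d m"
        using False assms by (metis One_nat_def Suc_lessI gcd_pos_nat gr_implies_not0 zero_less_iff_neq_zero)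
      show "gcd d m \<le> n"
        using assms by (metis gcd_le2_nat le_trans not_one_le_zero)
      show "gauss_sum d (int m) = 0"
        using False J gauss_sum_primitive[OF assms(1,2), of "int m"] by simp
      show "cmod (ramanujan_sum d (int m)) = real (totient (gcd d m))"
        using a by (auto simp: norm_mult)
    qed simp
  qed
qed

section \<open>Bounds for the power sums by F and G\<close>

lemma finite_totient_set:
  fixes d n :: nat
  shows "finite {real (totient f) / 2 |f. f dvd d \<and> 1 < f \<and> f \<le> n}"
  by (rule finite_surj[of "{..n}" _ "\<lambda>f. real (totient f) / 2"]) auto

lemma F_max_ge:
  shows "cmod (1 + sqrt_discr d) / 2 \<le> F_max d n"
    and "f dvd d \<Longrightarrow> 1 < f \<Longrightarrow> f \<le> n \<Longrightarrow> real (totient f) / 2 \<le> F_max d n"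
  unfolding F_max_def by (rule Max_ge; use finite_totient_set[of d n] in blast)+

lemma G_max_ge:
  shows "(1 + sqrt (real d)) / 2 \<le> G_max d n"
    and "f dvd d \<Longrightarrow> 1 < f \<Longrightarrow> f \<le> n \<Longrightarrow> real (totient f) / 2 \<le> G_max d n"
  unfolding G_max_def by (rule Max_ge; use finite_totient_set[of d n] in force)+

lemma cmod_power_sum_le_F_max:
  assumes "squarefree d" "odd d" "d > 1" "1 \<le> m" "m \<le> n" "s \<in> {1, -1}"
  shows "cmod ((ramanujan_sum d (int m) + of_int s * gauss_sum d (int m)) / 2) \<le> F_max d n"
  using assms(1-5)
proof (cases rule: power_sum_cases)
  case (divisor f)
  then show ?thesis
    using F_max_ge(2)[of f d n] assms by (simp add: norm_divide)
next
  case (unit a b)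
  have "cmod (a + of_int s * b * gauss_sum d 1) \<le> cmod (1 + sqrt_discr d)"
    using assms unit by (intro cmod_unit_add_gauss_sum_le) auto
  then show ?thesis
    using F_max_ge(1)[of d n] assms unit by (simp add: norm_divide mult.assoc)
qed

text \<open>The Ramanujan and Gauss parts are measured separately, so the coprime case costs (1 +
  sqrt d) / 2 instead of |1 + sqrt D| / 2.\<close>

lemma cmod_power_sum_le_G_max:
  assumes "squarefree d" "odd d" "d > 1" "1 \<le> m" "m \<le> n"
  shows "(cmod (ramanujan_sum d (int m)) + cmod (gauss_sum d (int m))) / 2 \<le> G_max d n"
  using assms
proof (cases rule: power_sum_cases)
  case (divisor f)
  then show ?thesis
    using G_max_ge(2)[of f d n] assms by simp
next
  case (unit a b)
  have "cmod a = 1" "cmod b = 1"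
    using unit by auto
  then show ?thesis
    using G_max_ge(1)[of d n] assms unit by (simp add: norm_mult cmod_gauss_sum)
qed

theorem theorem1:
  fixes d n :: nat
  assumes "d \<ge> 5" and "odd d" and "squarefree d"
    and "n \<le> totient d div 2"
  shows "cmod (a_coeff d n + b_coeff d n * sqrt_discr d)
           \<le> 2 * (\<Prod>i<n. F_max d n + real i) / fact n
       \<and> cmod (a_coeff d n) + cmod (b_coeff d n) * sqrt (real d)
           \<le> 2 * (\<Prod>i<n. G_max d n + real i) / fact n"
proof
  note d = \<open>squarefree d\<close> \<open>odd d\<close>
  have d1: "d > 1" "d > 0"
    using \<open>d \<ge> 5\<close> by auto
  let ?u = "\<lambda>s. rev_coeff s d"
  let ?c = "\<lambda>j. ramanujan_sum d (int (Suc j))"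
  let ?g = "\<lambda>j. gauss_sum d (int (Suc j))"
  have rev: "(\<Sum>j\<le>m. f (m - j)) = (\<Sum>j\<le>m. f j)" for f :: "nat \<Rightarrow> real" and m
    by (rule sum.reindex_bij_witness[of _ "\<lambda>j. m - j" "\<lambda>j. m - j"]) auto
  have cmod_scaled: "real k * cmod x = cmod y" if "of_nat k * x = - y" for k x y
  proof -
    have "real k * cmod x = cmod (of_nat k * x)"
      by (simp add: norm_mult)
    then show ?thesis
      by (simp only: that norm_minus_cancel)
  qed
  have a: "a_coeff d n = ?u 1 n + ?u (-1) n"
    and b: "b_coeff d n * sqrt_discr d = ?u (-1) n - ?u 1 n"
    using a_coeff_eq[OF d d1(1) assms(4)] b_coeff_mult_sqrt_discr[OF d d1(1) assms(4)] .

  show "cmod (a_coeff d n + b_coeff d n * sqrt_discr d)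
          \<le> 2 * (\<Prod>i<n. F_max d n + real i) / fact n"
  proof -
    \<comment> \<open>Adding the formulas for a and b sqrt D cancels the factor with s = 1 and
      leaves twice the coefficient for s = -1; this is the 2 in the bound.\<close>
    let ?w = "\<lambda>m. 2 * cmod (?u (-1) m)"
    have F: "F_max d n \<ge> 0"
      using F_max_ge(1)[of d n] norm_ge_zero[of "1 + sqrt_discr d"] by linarith
    have "?w n \<le> 2 * (\<Prod>i<n. F_max d n + real i) / fact n"
    proof (rule rising_factorial_majorant[OF F])
      fix m assume "m < n"
      have "real (Suc m) * cmod (?u (-1) (Suc m)) = cmod (of_nat (Suc m) * ?u (-1) (Suc m))"
        by (simp only: norm_mult norm_of_nat)
      also have "\<dots> \<le> (\<Sum>j\<le>m. cmod ((?c j + of_int (-1) * ?g j) / 2 * ?u (-1) (m - j)))"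
        using d1 by (subst rev_coeff_Suc) (auto simp only: norm_minus_cancel norm_sum insert_iff)
      also have "\<dots> \<le> (\<Sum>j\<le>m. F_max d n * cmod (?u (-1) (m - j)))"
        unfolding norm_mult using \<open>m < n\<close>
        by (intro sum_mono mult_right_mono cmod_power_sum_le_F_max[OF d d1(1)]) auto
      also have "\<dots> = F_max d n * (\<Sum>j\<le>m. cmod (?u (-1) j))"
        by (simp add: sum_distrib_left[symmetric] rev[of "\<lambda>j. cmod (?u (-1) j)"])
      finally show "real (Suc m) * ?w (Suc m) \<le> F_max d n * (\<Sum>j\<le>m. ?w j)"
        by (simp add: sum_distrib_left[symmetric] del: of_nat_Suc)
    qed (simp_all add: rev_coeff_0)
    then show ?thesis
      by (simp add: a b norm_mult)
  qed

  show "cmod (a_coeff d n) + cmod (b_coeff d n) * sqrt (real d)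
          \<le> 2 * (\<Prod>i<n. G_max d n + real i) / fact n"
  proof -
    \<comment> \<open>\<open>?A\<close> and \<open>?V\<close> stand for a and b sqrt D. They start
      with 2 and 0, so \<open>?w\<close> starts with 2.\<close>
    let ?A = "\<lambda>m. ?u 1 m + ?u (-1) m"
    let ?V = "\<lambda>m. ?u (-1) m - ?u 1 m"
    let ?w = "\<lambda>m. cmod (?A m) + cmod (?V m)"
    have G: "G_max d n \<ge> 0"
      by (rule order_trans[OF _ G_max_ge(1)[of d n]]) simp
    have "?w n \<le> 2 * (\<Prod>i<n. G_max d n + real i) / fact n"
    proof (rule rising_factorial_majorant[OF G])
      fix m assume "m < n"
      \<comment> \<open>With power sums (c + g)/2 and (c - g)/2 for s = 1 and s = -1, adding the two
        recursions pairs c with \<open>?A\<close> and g with \<open>?V\<close>; subtracting them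
        exchanges the roles.\<close>
      have "of_nat (Suc m) * ?A (Suc m) = - (\<Sum>j\<le>m. (?c j * ?A (m - j) - ?g j * ?V (m - j)) / 2)"
        unfolding distrib_left rev_coeff_Suc[OF d1(2) insertI1] 
          rev_coeff_Suc[OF d1(2) insertI2[OF singletonI]]
        unfolding minus_add_distrib[symmetric] sum.distrib[symmetric]
        by (intro arg_cong[where f = uminus] sum.cong refl)
           (simp add: algebra_simps add_divide_distrib diff_divide_distrib)
      then have A: "real (Suc m) * cmod (?A (Suc m)) 
          = cmod (\<Sum>j\<le>m. (?c j * ?A (m - j) - ?g j * ?V (m - j)) / 2)"
        by (rule cmod_scaled)
      have "of_nat (Suc m) * ?V (Suc m) = - (\<Sum>j\<le>m. (?c j * ?V (m - j) - ?g j * ?A (m - j)) / 2)"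
        unfolding right_diff_distrib rev_coeff_Suc[OF d1(2) insertI1] 
          rev_coeff_Suc[OF d1(2) insertI2[OF singletonI]]
        unfolding minus_diff_minus sum_subtractf[symmetric]
        by (intro arg_cong[where f = uminus] sum.cong refl)
           (simp add: algebra_simps add_divide_distrib diff_divide_distrib)
      then have V: "real (Suc m) * cmod (?V (Suc m)) 
          = cmod (\<Sum>j\<le>m. (?c j * ?V (m - j) - ?g j * ?A (m - j)) / 2)"
        by (rule cmod_scaled)
      have "real (Suc m) * ?w (Suc m) 
          \<le> (\<Sum>j\<le>m. cmod ((?c j * ?A (m - j) - ?g j * ?V (m - j)) / 2)
                  + cmod ((?c j * ?V (m - j) - ?g j * ?A (m - j)) / 2))"
        unfolding distrib_left A V sum.distrib by (intro add_mono norm_sum)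
      \<comment> \<open>Each of |A| and |V| occurs once with |c| and once with |g|, so the four
        products factor.\<close>
      also have "\<dots> \<le> (\<Sum>j\<le>m. (cmod (?c j) + cmod (?g j)) / 2 * ?w (m - j))"
      proof (rule sum_mono)
        fix j
        have *: "cmod ((x * y - z * t) / 2) \<le> (cmod x * cmod y + cmod z * cmod t) / 2" for x y z t
          using norm_triangle_ineq4[of "x * y" "z * t"] by (simp add: norm_divide norm_mult)
        show "cmod ((?c j * ?A (m - j) - ?g j * ?V (m - j)) / 2)
                  + cmod ((?c j * ?V (m - j) - ?g j * ?A (m - j)) / 2)
            \<le> (cmod (?c j) + cmod (?g j)) / 2 * ?w (m - j)"
          using add_mono[OF *[of "?c j" "?A (m - j)" "?g j" "?V (m - j)"] 
              *[of "?c j" "?V (m - j)" "?g j" "?A (m - j)"]]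
          by (simp add: field_simps)
      qed
      also have "\<dots> \<le> (\<Sum>j\<le>m. G_max d n * ?w (m - j))"
        using \<open>m < n\<close> by (intro sum_mono mult_right_mono cmod_power_sum_le_G_max[OF d d1(1)]) auto
      also have "\<dots> = G_max d n * (\<Sum>j\<le>m. ?w j)"
        unfolding sum_distrib_left[symmetric] rev[of ?w] ..
      finally show "real (Suc m) * ?w (Suc m) \<le> G_max d n * (\<Sum>j\<le>m. ?w j)" .
    qed (simp_all add: rev_coeff_0)
    moreover have "cmod (b_coeff d n) * sqrt (real d) = cmod (?V n)"
      by (metis b cmod_sqrt_discr norm_mult)
    ultimately show ?thesis
      by (simp add: a)
  qed
qed

end
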